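(* Let $\boldsymbol{z}=(\bar{\boldsymbol{x}},\bar\eta,\bar\gamma)$ be a range-branching-free (RBF) node solution with respect to some valid $\boldsymbol{w}$, and denote its objective value by $v_{RBF}=\bar\eta-\bar\gamma$. Moreover, for a valid tuple $\boldsymbol{u}$ let $v^*_{LP}(\boldsymbol{u})=\min_{(\boldsymbol{x},\eta,\gamma)\in\mathcal{Z}_{LP}(\boldsymbol{u})}(\eta-\gamma)$ denote the LP bound of the valid formulation defined by $\boldsymbol{u}$. Then $v_{RBF}\ge v^*_{LP}(\boldsymbol{w}')$ for all valid $\boldsymbol{w}'$ that satisfy the fractional range-respecting assumption, i.e. for all valid $\boldsymbol{w}'$ such that $(\boldsymbol{x},p_{\max}(\boldsymbol{x}),p_{\min}(\boldsymbol{x}))\in\mathcal{Z}_{LP}(\boldsymbol{w}')$ for every $\boldsymbol{x}\in\mathcal{X}_{LP}$.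
   Context: Let $N$ be a positive integer (the number of columns), let $A$ be a real matrix with $N$ columns and $\boldsymbol{b}$ a real vector of matching dimension. Define $\mathcal{X} = \{\boldsymbol{x}\in\{0,1\}^N : A\boldsymbol{x}\le \boldsymbol{b}\}$ and $\mathcal{X}_{LP}=\{\boldsymbol{x}\in[0,1]^N : A\boldsymbol{x}\le \boldsymbol{b}\}$. Each column $i\in\{1,\dots,N\}$ has a payoff $p_i\in[0,M]$ for some constant $M$; write $\boldsymbol{p}=(p_1,\dots,p_N)$. For $\boldsymbol{x}\in[0,1]^N$ define $p_{\min}(\boldsymbol{x})=\min_{i: x_i>0}p_i$ and $p_{\max}(\boldsymbol{x})=\max_{i:x_i>0}p_i$. Range-respecting/range-violating: a vector $(\boldsymbol{x},\eta,\gamma)\in[0,1]^N\times\mathbb{R}^2$ is range-respecting (with respect to $\boldsymbol{p}$) if $\eta\ge p_{\max}(\boldsymbol{x})$ and $\gamma\le p_{\min}(\boldsymbol{x})$, and range-violating otherwise. Valid formulation: let $\boldsymbol{w}=(C,\boldsymbol{d},\boldsymbol{f},\boldsymbol{g})$ be a tuple consisting of a real matrix $C$ with $N$ columns and real vectors $\boldsymbol{d},\boldsymbol{f},\boldsymbol{g}$ of matching dimension. It defines the mixed-binary linear program $$\min_{\boldsymbol{x},\eta,\gamma}\ \eta-\gamma\quad\text{s.t.}\quad A\boldsymbol{x}\le\boldsymbol{b},\quad C\boldsymbol{x}+\eta\boldsymbol{d}+\gamma\boldsymbol{f}\le\boldsymbol{g},\quad \boldsymbol{x}\in\{0,1\}^N,\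 \eta,\gamma\in\mathbb{R}.$$ The program is a valid formulation (and $\boldsymbol{w}$ is called valid) when $(\boldsymbol{x},\eta,\gamma)$ is feasible in it if and only if $\boldsymbol{x}\in\mathcal{X}$ and $(\boldsymbol{x},\eta,\gamma)$ is range-respecting. $\mathcal{Z}_{LP}(\boldsymbol{w})$ denotes the feasible region of its LP relaxation, obtained by replacing $\boldsymbol{x}\in\{0,1\}^N$ by $\boldsymbol{x}\in[0,1]^N$. The matrices $A$, vector $\boldsymbol{b}$ and payoffs $\boldsymbol{p}$ are fixed; different tuples $\boldsymbol{w},\boldsymbol{w}'$ (possibly with different numbers of constraints) give different formulations. Range branching: the program defined by $\boldsymbol{w}$ is solved by LP-based branch and bound (branch and price). At every node one solves the LP relaxation with feasible region $\mathcal{Z}_{LP}(\boldsymbol{w})$ together with the additional restrictions imposed by the branching decisions on the path from the root to that node; let $(\bar{\boldsymbol{x}},\bar\eta,\bar\gamma)$ be the solution obtained (in particular it lies in $\mathcal{Z}_{LP}(\boldsymbol{w})$). The range branching rule is invoked first at each node: - If $\bar\eta<p_{\max}(\bar{\boldsymbol{x}})$, it can branch by choosing a cutoff $U\in(\bar\eta,p_{\max}(\bar{\boldsymbol{x}}))$ and creating two children: one imposing $\eta\le U$ and $x_i=0$ for all $i$ with $p_i>U$, the other imposing $\eta\ge U$. - If $\bar\gamma>p_{\min}(\bar{\boldsymbol{x}})$, it can branch by choosing a cutoff $L\in(p_{\min}(\bar{\boldsymbol{x}}),\bar\gamma)$ and creating two children: one imposing $\gamma\ge L$ and $x_i=0$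 for all $i$ with $p_i<L$, the other imposing $\gamma\le L$. - If neither inequality holds, the rule creates no branches (it detects no branching opportunity), and a problem-specific branching scheme is used instead. An RBF node solution with respect to $\boldsymbol{w}$ is any solution vector $(\bar{\boldsymbol{x}},\bar\eta,\bar\gamma)$ encountered at any node of the branch-and-bound tree when solving the formulation defined by $\boldsymbol{w}$, for which the range branching rule does not detect any branching opportunity. *)

theory Defs
  imports "HOL-Analysis.Analysis"
begin

text \<open>
  Vectors are compared by the componentwise order on \<^typ>\<open>real ^ 'n\<close>. Columns are indexed by a
  finite type \<open>'n\<close>; the row index types of different constraint systems are unrelated.
\<close>

definition X_IP :: "real^'n^'m \<Rightarrow> real^'m \<Rightarrow> (real^'n) set" where
  "X_IP A b = {x. (\<forall>i. x $ i \<in> {0, 1}) \<and> A *v x \<le> b}"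

definition X_LP :: "real^'n^'m \<Rightarrow> real^'m \<Rightarrow> (real^'n) set" where
  "X_LP A b = {x. (\<forall>i. x $ i \<in> {0..1}) \<and> A *v x \<le> b}"

text \<open>
  The supremum and infimum range over a finite set, so they are a maximum and a minimum unless
  \<open>x = 0\<close>. For \<open>x = 0\<close> the usual convention for empty extrema applies: \<open>p_max = -\<infinity>\<close>, \<open>p_min = \<infinity>\<close>.
\<close>

definition p_max :: "real^'n \<Rightarrow> real^'n \<Rightarrow> ereal" where
  "p_max p x = (SUP i\<in>{i. x $ i > 0}. ereal (p $ i))"

definition p_min :: "real^'n \<Rightarrow> real^'n \<Rightarrow> ereal" where
  "p_min p x = (INF i\<in>{i. x $ i > 0}. ereal (p $ i))"

type_synonym 'n point = "(real^'n) \<times> real \<times> real"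

fun range_respecting :: "real^'n \<Rightarrow> 'n point \<Rightarrow> bool" where
  "range_respecting p (x, \<eta>, \<gamma>) \<longleftrightarrow> ereal \<eta> \<ge> p_max p x \<and> ereal \<gamma> \<le> p_min p x"

fun objective :: "'n point \<Rightarrow> real" where
  "objective (x, \<eta>, \<gamma>) = \<eta> - \<gamma>"

text \<open>The tuple \<open>(C, d, f, g)\<close>.\<close>

type_synonym ('n, 'k) formulation = "(real^'n^'k) \<times> (real^'k) \<times> (real^'k) \<times> (real^'k)"

fun Z_IP :: "real^'n^'m \<Rightarrow> real^'m \<Rightarrow> ('n, 'k::finite) formulation \<Rightarrow> 'n point set" where
  "Z_IP A b (C, d, f, g) =
     {(x, \<eta>, \<gamma>). A *v x \<le> b \<and> C *v x + \<eta> *\<^sub>R d + \<gamma> *\<^sub>R f \<le> g \<and> (\<forall>i. x $ i \<in> {0, 1})}"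

fun Z_LP :: "real^'n^'m \<Rightarrow> real^'m \<Rightarrow> ('n, 'k::finite) formulation \<Rightarrow> 'n point set" where
  "Z_LP A b (C, d, f, g) =
     {(x, \<eta>, \<gamma>). A *v x \<le> b \<and> C *v x + \<eta> *\<^sub>R d + \<gamma> *\<^sub>R f \<le> g \<and> (\<forall>i. x $ i \<in> {0..1})}"

definition valid_formulation ::
    "real^'n^'m \<Rightarrow> real^'m \<Rightarrow> real^'n \<Rightarrow> ('n, 'k::finite) formulation \<Rightarrow> bool" where
  "valid_formulation A b p w \<longleftrightarrow>
     (\<forall>x \<eta> \<gamma>. (x, \<eta>, \<gamma>) \<in> Z_IP A b w \<longleftrightarrow> x \<in> X_IP A b \<and> range_respecting p (x, \<eta>, \<gamma>))"

text \<open>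
  Optimal value of the LP relaxation, \<open>-\<infinity>\<close> if it is unbounded and \<open>\<infinity>\<close> if it is infeasible; a
  feasible bounded linear program attains its infimum.
\<close>

definition v_LP :: "real^'n^'m \<Rightarrow> real^'m \<Rightarrow> ('n, 'k::finite) formulation \<Rightarrow> ereal" where
  "v_LP A b w = (INF z\<in>Z_LP A b w. ereal (objective z))"

text \<open>
  The points \<open>(x, p_max p x, p_min p x)\<close> are real vectors except for \<open>x = 0\<close>, where the condition
  is void.
\<close>

definition fractional_range_respecting ::
    "real^'n^'m \<Rightarrow> real^'m \<Rightarrow> real^'n \<Rightarrow> ('n, 'k::finite) formulation \<Rightarrow> bool" where
  "fractional_range_respecting A b p w \<longleftrightarrow>
     (\<forall>x\<in>X_LP A b. \<forall>\<eta> \<gamma>. ereal \<eta> = p_max p x \<and> ereal \<gamma> = p_min p x \<longrightarrow> (x, \<eta>, \<gamma>) \<in> Z_LP A b w)"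

text \<open>
  A node is represented by the set of points satisfying all restrictions imposed on the path from
  the root to it.
\<close>

definition node_LP_solution ::
    "real^'n^'m \<Rightarrow> real^'m \<Rightarrow> ('n, 'k::finite) formulation \<Rightarrow> 'n point set \<Rightarrow> 'n point \<Rightarrow> bool" where
  "node_LP_solution A b w R z \<longleftrightarrow> is_arg_min objective (\<lambda>z'. z' \<in> Z_LP A b w \<inter> R) z"

fun detects_range_branching :: "real^'n \<Rightarrow> 'n point \<Rightarrow> bool" where
  "detects_range_branching p (x, \<eta>, \<gamma>) \<longleftrightarrow> ereal \<eta> < p_max p x \<or> ereal \<gamma> > p_min p x"

text \<open>
  \<open>range_branching p z Ds\<close>: at the node solution \<open>z\<close>, range branching can create two children that
  impose the two restrictions in \<open>Ds\<close>.
\<close>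

inductive range_branching :: "real^'n \<Rightarrow> 'n point \<Rightarrow> 'n point set set \<Rightarrow> bool"
  for p :: "real^'n" where
  upper: "ereal \<eta> < ereal U \<Longrightarrow> ereal U < p_max p x \<Longrightarrow>
    range_branching p (x, \<eta>, \<gamma>)
      {{(y, \<mu>, \<nu>). \<mu> \<le> U \<and> (\<forall>i. p $ i > U \<longrightarrow> y $ i = 0)}, {(y, \<mu>, \<nu>). \<mu> \<ge> U}}"
| lower: "p_min p x < ereal L \<Longrightarrow> ereal L < ereal \<gamma> \<Longrightarrow>
    range_branching p (x, \<eta>, \<gamma>)
      {{(y, \<mu>, \<nu>). \<nu> \<ge> L \<and> (\<forall>i. p $ i < L \<longrightarrow> y $ i = 0)}, {(y, \<mu>, \<nu>). \<nu> \<le> L}}"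

text \<open>
  Nodes that can occur in a branch-and-bound tree, over all choices of cutoffs and of optimal LP
  solutions. The problem-specific scheme \<open>S\<close> is arbitrary: \<open>S R z\<close> is the set of restrictions imposed
  by the children it creates at node \<open>R\<close> with solution \<open>z\<close>. Pruning only removes nodes.
\<close>

inductive bb_node ::
    "real^'n^'m \<Rightarrow> real^'m \<Rightarrow> real^'n \<Rightarrow> ('n, 'k::finite) formulation \<Rightarrow>
     ('n point set \<Rightarrow> 'n point \<Rightarrow> 'n point set set) \<Rightarrow> 'n point set \<Rightarrow> bool"
  for A :: "real^'n^'m" and b :: "real^'m" and p :: "real^'n" and w :: "('n, 'k::finite) formulation"
    and S :: "'n point set \<Rightarrow> 'n point \<Rightarrow> 'n point set set" where
  root: "bb_node A b p w S UNIV"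
| range_child: "bb_node A b p w S R \<Longrightarrow> node_LP_solution A b w R z \<Longrightarrow>
    range_branching p z Ds \<Longrightarrow> D \<in> Ds \<Longrightarrow> bb_node A b p w S (R \<inter> D)"
| specific_child: "bb_node A b p w S R \<Longrightarrow> node_LP_solution A b w R z \<Longrightarrow>
    \<not> detects_range_branching p z \<Longrightarrow> D \<in> S R z \<Longrightarrow> bb_node A b p w S (R \<inter> D)"

definition RBF_node_solution ::
    "real^'n^'m \<Rightarrow> real^'m \<Rightarrow> real^'n \<Rightarrow> ('n, 'k::finite) formulation \<Rightarrow>
     ('n point set \<Rightarrow> 'n point \<Rightarrow> 'n point set set) \<Rightarrow> 'n point \<Rightarrow> bool" where
  "RBF_node_solution A b p w S z \<longleftrightarrow>
     (\<exists>R. bb_node A b p w S R \<and> node_LP_solution A b w R z) \<and> \<not> detects_range_branching p z"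

end

theory Submission
  imports Defs
begin

text \<open>
  The RBF node solution \<open>z = (x, \<eta>, \<gamma>)\<close> has two properties: it is range-respecting,
  because the range branching rule finds nothing to branch on, and its \<open>x\<close>-part lies in
  \<^term>\<open>X_LP A b\<close>, because every node only adds restrictions to the LP relaxation of the formulation.

  If \<open>x \<noteq> 0\<close>, the minimal and maximal payoff on the support of \<open>x\<close> are real numbers, and together
  with \<open>x\<close> they form a point of the relaxation of \<open>w'\<close> by the fractional range-respecting
  assumption. Its objective value \<open>p_max - p_min\<close> is at most \<open>\<eta> - \<gamma>\<close>, since \<open>\<eta> \<ge> p_max\<close> and
  \<open>\<gamma> \<le> p_min\<close>.

  If \<open>x = 0\<close>, the extrema are infinite and that assumption says nothing. But \<open>x\<close> is then binary,
  so validity of \<open>w'\<close> makes \<open>z\<close> itself feasible for \<open>w'\<close>, and hence for its relaxation.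
\<close>

text \<open>
  On a nonempty support, the extrema that define \<^const>\<open>p_max\<close> and \<^const>\<open>p_min\<close> range over a
  nonempty finite set. Hence they are attained, and in particular they are real.
\<close>

lemma p_max_attained:
  assumes "x $ j > 0"
  obtains i where "p_max p x = ereal (p $ i)"
proof -
  have "p_max p x \<in> (\<lambda>i. ereal (p $ i)) ` {i. x $ i > 0}"
    unfolding p_max_def using assms by (intro finite_Sup_in) (auto simp: sup_max max_def)
  then show thesis using that by blast
qed

lemma p_min_attained:
  assumes "x $ j > 0"
  obtains i where "p_min p x = ereal (p $ i)"
proof -
  have "p_min p x \<in> (\<lambda>i. ereal (p $ i)) ` {i. x $ i > 0}"
    unfolding p_min_def using assms by (intro finite_Inf_in) (auto simp: inf_min min_def)
  then show thesis using that by blast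
qed

lemma Z_IP_subset_Z_LP: "Z_IP A b w \<subseteq> Z_LP A b w"
proof (cases w)
  case (fields C d f g)
  have "t \<in> {0..1}" if "t \<in> {0, 1}" for t :: real
    using that by auto
  then show ?thesis
    unfolding fields by auto
qed

lemma Z_LP_imp_X_LP: "(x, \<eta>, \<gamma>) \<in> Z_LP A b w \<Longrightarrow> x \<in> X_LP A b"
  by (cases w) (auto simp: X_LP_def)

lemma RBF_node_solution_imp_X_LP:
  "RBF_node_solution A b p w S (x, \<eta>, \<gamma>) \<Longrightarrow> x \<in> X_LP A b"
  by (auto simp: RBF_node_solution_def node_LP_solution_def is_arg_min_def intro: Z_LP_imp_X_LP)

lemma RBF_node_solution_imp_range_respecting:
  "RBF_node_solution A b p w S (x, \<eta>, \<gamma>) \<Longrightarrow> range_respecting p (x, \<eta>, \<gamma>)"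
  by (auto simp: RBF_node_solution_def not_less)

lemma v_LP_le_objective: "z \<in> Z_LP A b w \<Longrightarrow> v_LP A b w \<le> ereal (objective z)"
  unfolding v_LP_def by (rule INF_lower)

text \<open>
  Validity takes care of \<open>x = 0\<close>, where both extrema are infinite, and the fractional
  range-respecting assumption of all other \<open>x\<close>.
\<close>

lemma range_respecting_objective_ge_v_LP:
  assumes x: "x \<in> X_LP A b"
    and rr: "range_respecting p (x, \<eta>, \<gamma>)"
    and valid: "valid_formulation A b p w"
    and frac: "fractional_range_respecting A b p w"
  shows "v_LP A b w \<le> ereal (objective (x, \<eta>, \<gamma>))"
proof (cases "x = 0")
  case True
  then have "x \<in> X_IP A b"
    using x by (simp add: X_LP_def X_IP_def)
  then have "(x, \<eta>, \<gamma>) \<in> Z_IP A b w"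
    using valid rr by (simp add: valid_formulation_def)
  then have "(x, \<eta>, \<gamma>) \<in> Z_LP A b w"
    using Z_IP_subset_Z_LP by (rule rev_subsetD)
  then show ?thesis by (rule v_LP_le_objective)
next
  case False
  have "x $ i \<ge> 0" for i
    using x by (simp add: X_LP_def)
  then obtain j where j: "x $ j > 0"
    using False by (metis order_le_less vec_eq_iff zero_index)
  obtain k where k: "p_max p x = ereal (p $ k)" using j by (rule p_max_attained)
  obtain l where l: "p_min p x = ereal (p $ l)" using j by (rule p_min_attained)
  have "(x, p $ k, p $ l) \<in> Z_LP A b w"
    using frac x k l by (simp add: fractional_range_respecting_def)
  then have "v_LP A b w \<le> ereal (objective (x, p $ k, p $ l))"
    by (rule v_LP_le_objective)
  also have "\<dots> \<le> ereal (objective (x, \<eta>, \<gamma>))"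
    using rr k l by simp
  finally show ?thesis .
qed

theorem proposition5:
  fixes A :: "real^'n^'m" and b :: "real^'m" and p :: "real^'n" and M :: real
    and w :: "('n, 'k::finite) formulation" and w' :: "('n, 'l::finite) formulation"
    and S :: "'n point set \<Rightarrow> 'n point \<Rightarrow> 'n point set set"
    and z :: "'n point"
  assumes "\<forall>i. p $ i \<in> {0..M}"
    and "valid_formulation A b p w"
    and "RBF_node_solution A b p w S z"
    and "valid_formulation A b p w'"
    and "fractional_range_respecting A b p w'"
  shows "ereal (objective z) \<ge> v_LP A b w'"
proof -
  obtain x \<eta> \<gamma> where z: "z = (x, \<eta>, \<gamma>)" by (cases z)
  show ?thesis
    unfolding z
    using RBF_node_solution_imp_X_LP[OF assms(3)[unfolded z]]
      RBF_node_solution_imp_range_respecting[OF assms(3)[unfolded z]] assms(4,5)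
    by (rule range_respecting_objective_ge_v_LP)
qed

end
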